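(* Let $G$ be a finite abstract simplicial complex and let $T:G\to G$ be an invertible simplicial map. Let $F=\{x\in G: T(x)=x\}$. Then $\chi_T(G)=\sum_{x\in F} i_T(x)$, where $\chi_T(G)$ is the Lefschetz number of $T$ and $i_T(x)=\omega(x)\,\mathrm{sign}(T|x)$ is the index of the fixed point $x$.
   Context: A finite abstract simplicial complex $G$ is a finite set of non-empty finite sets closed under taking non-empty subsets; $\dim(x)=|x|-1$, $\omega(x)=(-1)^{\dim(x)}$, $q=\max_{x\in G}\dim(x)$. A map $T:G\to G$ is simplicial if it maps $0$-dimensional simplices to $0$-dimensional simplices and $x\subset y$ implies $T(x)\subset T(y)$; it is invertible if it is a bijection. Fix for each $x\in G$ an arbitrary ordering of its vertices. Let $\Lambda$ be the space of functions $f:G\to\mathbb{R}$ with the standard inner product, and $\Lambda_k$ the functions supported on $G_k=\{x\in G:\dim(x)=k\}$. The exterior derivative is $df(x)=\sum_{y\subset x,\ \dim(y)=\dim(x)-1}\mathrm{sign}(x,y)f(y)$, where $\mathrm{sign}(x,y)$ is the signature of the permutation taking the ordered tuple $(v,y)$, $v$ being the element of $x\setminus y$ followed by the ordered vertices of $y$, to the ordered tuple $x$. Then $d^2=0$; let $H=(d+d^* )^2$ and let $H_k$ be its restriction to $\Lambda_k$. For $x=(x_0,\dots,x_k)$ in its chosen order, $\mathrm{sign}(T|x)$ is the signature of the permutation taking the tuple $(T(x_0),\dots,T(x_k))$ to the chosen ordering of $T(x)$; for $x$ with $T(x)=x$ this is the sign of the permutation that $T$ induces on the vertices of $x$. The Koopman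 operator is $(Uf)(x)=\mathrm{sign}(T|x)\,f(T(x))$; it commutes with $d$ and $H$ and preserves each $\ker(H_k)$. The Lefschetz number is $\chi_T(G)=\sum_{k=0}^q(-1)^k\,\mathrm{tr}(U|_{\ker(H_k)})$. *)

theory Defs
  imports Complex_Main "HOL-Library.Function_Algebras" "HOL-Combinatorics.Permutations"
begin

section \<open>Traces on subspaces of function spaces\<close>

definition fscale :: "real \<Rightarrow> ('b \<Rightarrow> real) \<Rightarrow> 'b \<Rightarrow> real" where
  "fscale c f = (\<lambda>x. c * f x)"

global_interpretation fun_space: vector_space "fscale :: real \<Rightarrow> ('b \<Rightarrow> real) \<Rightarrow> 'b \<Rightarrow> real"
  by unfold_locales (auto simp: fscale_def fun_eq_iff algebra_simps)

text \<open>
  Trace of the restriction of \<open>A\<close> to a finite-dimensional invariant subspace \<open>W\<close>: the sum of the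
  diagonal entries of its matrix with respect to a basis of \<open>W\<close>.
\<close>
definition trace_on :: "('b \<Rightarrow> real) set \<Rightarrow> (('b \<Rightarrow> real) \<Rightarrow> ('b \<Rightarrow> real)) \<Rightarrow> real" where
  "trace_on W A =
    (let B = (SOME B. fun_space.independent B \<and> fun_space.span B = W)
     in \<Sum>b\<in>B. fun_space.representation B (A b) b)"

section \<open>Simplicial complexes and simplicial maps\<close>

definition simplicial_complex :: "'a set set \<Rightarrow> bool" where
  "simplicial_complex G \<longleftrightarrow>
    finite G \<and> (\<forall>x\<in>G. finite x \<and> x \<noteq> {}) \<and> (\<forall>x\<in>G. \<forall>y. y \<subseteq> x \<and> y \<noteq> {} \<longrightarrow> y \<in> G)"

text \<open>The truncated subtraction is harmless, since simplices are non-empty.\<close>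
definition sdim :: "'a set \<Rightarrow> nat" where
  "sdim x = card x - 1"

definition max_dim :: "'a set set \<Rightarrow> nat" where
  "max_dim G = Max (sdim ` G)"

definition omega :: "'a set \<Rightarrow> real" where
  "omega x = (-1) ^ sdim x"

definition simplicial_map :: "'a set set \<Rightarrow> ('a set \<Rightarrow> 'a set) \<Rightarrow> bool" where
  "simplicial_map G T \<longleftrightarrow>
    (\<forall>x\<in>G. T x \<in> G) \<and>
    (\<forall>x\<in>G. sdim x = 0 \<longrightarrow> sdim (T x) = 0) \<and>
    (\<forall>x\<in>G. \<forall>y\<in>G. x \<subseteq> y \<longrightarrow> T x \<subseteq> T y)"

text \<open>The action on vertices: \<open>T {v} = {vertex_map T v}\<close>.\<close>
definition vertex_map :: "('a set \<Rightarrow> 'a set) \<Rightarrow> 'a \<Rightarrow> 'a" where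
  "vertex_map T v = the_elem (T {v})"

definition vertex_ordering :: "'a set set \<Rightarrow> ('a set \<Rightarrow> 'a list) \<Rightarrow> bool" where
  "vertex_ordering G ord \<longleftrightarrow> (\<forall>x\<in>G. distinct (ord x) \<and> set (ord x) = x)"

text \<open>
  Signature of the permutation taking the tuple \<open>xs\<close> to its rearrangement \<open>ys\<close>. For tuples
  without repetitions that permutation is unique.
\<close>
definition tuple_sign :: "'a list \<Rightarrow> 'a list \<Rightarrow> real" where
  "tuple_sign xs ys =
    of_int (sign (THE p. p permutes {..<length xs} \<and> permute_list p xs = ys))"

definition face_sign :: "('a set \<Rightarrow> 'a list) \<Rightarrow> 'a set \<Rightarrow> 'a set \<Rightarrow> real" where
  "face_sign ord x y = tuple_sign (the_elem (x - y) # ord y) (ord x)"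

definition map_sign :: "('a set \<Rightarrow> 'a list) \<Rightarrow> ('a set \<Rightarrow> 'a set) \<Rightarrow> 'a set \<Rightarrow> real" where
  "map_sign ord T x = tuple_sign (map (vertex_map T) (ord x)) (ord (T x))"

section \<open>Forms, the Hodge Laplacian and the Lefschetz number\<close>

text \<open>Functions on \<open>G\<close> are represented by functions on all sets that vanish outside \<open>G\<close>.\<close>
definition forms :: "'a set set \<Rightarrow> ('a set \<Rightarrow> real) set" where
  "forms G = {f. \<forall>x. x \<notin> G \<longrightarrow> f x = 0}"

definition k_forms :: "'a set set \<Rightarrow> nat \<Rightarrow> ('a set \<Rightarrow> real) set" where
  "k_forms G k = forms {x \<in> G. sdim x = k}"

definition form_inner :: "'a set set \<Rightarrow> ('a set \<Rightarrow> real) \<Rightarrow> ('a set \<Rightarrow> real) \<Rightarrow> real" where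
  "form_inner G f g = (\<Sum>x\<in>G. f x * g x)"

text \<open>The adjoint is determined only on \<open>forms G\<close>, and is used only there.\<close>
definition form_adjoint ::
  "'a set set \<Rightarrow> (('a set \<Rightarrow> real) \<Rightarrow> ('a set \<Rightarrow> real)) \<Rightarrow> ('a set \<Rightarrow> real) \<Rightarrow> ('a set \<Rightarrow> real)" where
  "form_adjoint G A =
    (SOME A'. (\<forall>g\<in>forms G. A' g \<in> forms G) \<and>
       (\<forall>f\<in>forms G. \<forall>g\<in>forms G. form_inner G (A f) g = form_inner G f (A' g)))"

definition ext_deriv ::
  "'a set set \<Rightarrow> ('a set \<Rightarrow> 'a list) \<Rightarrow> ('a set \<Rightarrow> real) \<Rightarrow> ('a set \<Rightarrow> real)" where
  "ext_deriv G ord f =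
    (\<lambda>x. if x \<in> G
         then \<Sum>y | y \<in> G \<and> y \<subset> x \<and> sdim x = sdim y + 1. face_sign ord x y * f y
         else 0)"

definition dirac ::
  "'a set set \<Rightarrow> ('a set \<Rightarrow> 'a list) \<Rightarrow> ('a set \<Rightarrow> real) \<Rightarrow> ('a set \<Rightarrow> real)" where
  "dirac G ord f = ext_deriv G ord f + form_adjoint G (ext_deriv G ord) f"

definition hodge_laplacian ::
  "'a set set \<Rightarrow> ('a set \<Rightarrow> 'a list) \<Rightarrow> ('a set \<Rightarrow> real) \<Rightarrow> ('a set \<Rightarrow> real)" where
  "hodge_laplacian G ord f = dirac G ord (dirac G ord f)"

definition harmonic_forms ::
  "'a set set \<Rightarrow> ('a set \<Rightarrow> 'a list) \<Rightarrow> nat \<Rightarrow> ('a set \<Rightarrow> real) set" where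
  "harmonic_forms G ord k = {f \<in> k_forms G k. hodge_laplacian G ord f = 0}"

definition koopman ::
  "'a set set \<Rightarrow> ('a set \<Rightarrow> 'a list) \<Rightarrow> ('a set \<Rightarrow> 'a set) \<Rightarrow> ('a set \<Rightarrow> real) \<Rightarrow> ('a set \<Rightarrow> real)" where
  "koopman G ord T f = (\<lambda>x. if x \<in> G then map_sign ord T x * f (T x) else 0)"

text \<open>
  If \<open>G\<close> is empty, \<open>max_dim G\<close> is unspecified, but all summands are traces on the zero space.
\<close>
definition lefschetz_number ::
  "'a set set \<Rightarrow> ('a set \<Rightarrow> 'a list) \<Rightarrow> ('a set \<Rightarrow> 'a set) \<Rightarrow> real" where
  "lefschetz_number G ord T =
    (\<Sum>k = 0..max_dim G. (-1) ^ k * trace_on (harmonic_forms G ord k) (koopman G ord T))"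

definition fixed_simplices :: "'a set set \<Rightarrow> ('a set \<Rightarrow> 'a set) \<Rightarrow> 'a set set" where
  "fixed_simplices G T = {x \<in> G. T x = x}"

definition fixed_index :: "('a set \<Rightarrow> 'a list) \<Rightarrow> ('a set \<Rightarrow> 'a set) \<Rightarrow> 'a set \<Rightarrow> real" where
  "fixed_index ord T x = omega x * map_sign ord T x"

end

(*
  If D is linear and commutes with A, then the trace of A on a space W is the sum of its traces on
  the kernel of D in W and on D(W). The Koopman operator U is a signed permutation that commutes with
  d and d^*. Taking D = d on the k-forms gives tr(k-forms) = tr(closed k-forms) + tr(exact
  (k+1)-forms); taking D = d d^* on the closed k-forms, where its kernel is the harmonic forms and
  its image the exact forms, gives tr(closed k-forms) = tr(harmonic k-forms) + tr(exact k-forms).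
  In the alternating sum the exact parts telescope, so the Lefschetz number is the alternating sum of
  the traces of U on all k-forms, and the diagonal entry of U at x is sign(T|x) if T(x) = x and 0
  otherwise.
*)
theory Submission
  imports Defs
begin

section \<open>Signatures of tuple rearrangements\<close>

text \<open>Distinct entries determine their positions, so the permutation in the definite
  description is unique and any witness computes the sign.\<close>

lemma tuple_sign_eq:
  assumes "distinct xs" "p permutes {..<length xs}" "permute_list p xs = ys"
  shows "tuple_sign xs ys = of_int (sign p)"
proof -
  have "(THE q. q permutes {..<length xs} \<and> permute_list q xs = ys) = p"
  proof (rule the_equality)
    fix q assume q: "q permutes {..<length xs} \<and> permute_list q xs = ys"
    show "q = p"
    proof
      fix i show "q i = p i"
      proof (cases "i < length xs")
        case True
        have "xs ! q i = xs ! p i"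
          using q assms True by (metis permute_list_nth)
        moreover have "q i < length xs" "p i < length xs"
          using q assms(2) True permutes_in_image by (metis lessThan_iff)+
        ultimately show ?thesis using assms(1) nth_eq_iff_index_eq by blast
      next
        case False
        then show ?thesis using q assms(2) by (auto simp: permutes_def)
      qed
    qed
  qed (use assms in auto)
  then show ?thesis by (simp add: tuple_sign_def)
qed

lemma obtain_tuple_permutation:
  assumes "distinct xs" "distinct ys" "set xs = set ys"
  obtains p where "p permutes {..<length xs}" "permute_list p xs = ys"
    "tuple_sign xs ys = of_int (sign p)"
proof -
  have "mset ys = mset xs"
    using assms set_eq_iff_mset_eq_distinct by metis
  then obtain p where "p permutes {..<length xs}" "permute_list p xs = ys"
    by (rule mset_eq_permutation)
  with tuple_sign_eq[OF assms(1)] that show ?thesis by blast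
qed

text \<open>The rearranging permutations compose and \<open>sign\<close> is multiplicative. This
  rule reduces the sign identities for faces to comparisons of tuples.\<close>

lemma tuple_sign_trans:
  assumes "distinct xs" "distinct ys" "distinct zs" "set xs = set ys" "set ys = set zs"
  shows "tuple_sign xs ys * tuple_sign ys zs = tuple_sign xs zs"
proof -
  obtain p where p: "p permutes {..<length xs}" "permute_list p xs = ys"
    "tuple_sign xs ys = of_int (sign p)"
    using obtain_tuple_permutation assms(1,2,4) by metis
  obtain q where q: "q permutes {..<length ys}" "permute_list q ys = zs"
    "tuple_sign ys zs = of_int (sign q)"
    using obtain_tuple_permutation assms(2,3,5) by metis
  have len: "length ys = length xs" using p(2) by auto
  have "tuple_sign xs zs = of_int (sign (p \<circ> q))"
    using assms(1) p q len
    by (intro tuple_sign_eq) (auto simp: permute_list_compose permutes_compose)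
  moreover have "sign (p \<circ> q) = sign p * sign q"
    using p q by (intro sign_compose permutes_imp_permutation[of "{..<_}"]) auto
  ultimately show ?thesis using p q by simp
qed

lemma tuple_sign_square:
  assumes "distinct xs" "distinct ys" "set xs = set ys"
  shows "tuple_sign xs ys * tuple_sign xs ys = 1"
proof -
  obtain p :: "nat \<Rightarrow> nat" where "tuple_sign xs ys = of_int (sign p)"
    using obtain_tuple_permutation assms by metis
  then show ?thesis by (simp flip: of_int_mult)
qed

text \<open>The same permutation of positions rearranges the relabelled tuples; injectivity keeps
  their entries distinct.\<close>

lemma tuple_sign_map:
  assumes "distinct xs" "distinct ys" "set xs = set ys" "inj_on f (set xs)"
  shows "tuple_sign (map f xs) (map f ys) = tuple_sign xs ys"
proof -
  obtain p where p: "p permutes {..<length xs}" "permute_list p xs = ys"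
    "tuple_sign xs ys = of_int (sign p)"
    using obtain_tuple_permutation assms by metis
  then have "tuple_sign (map f xs) (map f ys) = of_int (sign p)"
    using assms by (intro tuple_sign_eq) (auto simp: distinct_map permute_list_map)
  with p show ?thesis by simp
qed

text \<open>Shifting all positions by one transports the permutation without changing its
  sign.\<close>

lemma tuple_sign_Cons:
  assumes "distinct (a # xs)" "distinct ys" "set xs = set ys"
  shows "tuple_sign (a # xs) (a # ys) = tuple_sign xs ys"
proof -
  obtain p where p: "p permutes {..<length xs}" "permute_list p xs = ys"
    "tuple_sign xs ys = of_int (sign p)"
    using obtain_tuple_permutation assms by (metis distinct.simps(2))
  \<comment> \<open>\<open>q\<close> acts on \<open>Suc i\<close> as \<open>p\<close> acts on
    \<open>i\<close>; position 0, the head, lies outside the image of \<open>Suc\<close> and stays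
    fixed.\<close>
  define q where "q = map_permutation {..<length xs} Suc p"
  have "q permutes Suc ` {..<length xs}"
    unfolding q_def using p by (intro map_permutation_permutes) (auto simp: bij_betw_def)
  then have q: "q permutes {..<length (a # xs)}" and q0: "q 0 = 0"
    using permutes_subset[of q "Suc ` {..<length xs}" "{..<length (a # xs)}"] permutes_not_in
    by fastforce+
  have qS: "q (Suc i) = Suc (p i)" if "i < length xs" for i
    unfolding q_def using p that by (intro map_permutation_apply) auto
  have "permute_list q (a # xs) = a # ys"
    using p(2) q0 qS by (auto simp: permute_list_def upt_conv_Cons simp flip: map_Suc_upt
      simp del: upt_Suc)
  with q assms(1) have "tuple_sign (a # xs) (a # ys) = of_int (sign q)"
    by (intro tuple_sign_eq)
  also have "sign q = sign p"
    unfolding q_def using p by (intro sign_map_permutation) auto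
  finally show ?thesis using p by simp
qed

text \<open>A single transposition of positions; it is the source of the cancellation in
  \<open>d (d f) = 0\<close>.\<close>

lemma tuple_sign_swap:
  assumes "distinct (a # b # xs)"
  shows "tuple_sign (a # b # xs) (b # a # xs) = -1"
proof -
  let ?t = "Transposition.transpose 0 (Suc 0)"
  have "permute_list ?t (a # b # xs) = b # a # xs"
    by (rule nth_equalityI)
       (auto simp: permute_list_def Transposition.transpose_def nth_Cons' simp del: upt_Suc)
  then have "tuple_sign (a # b # xs) (b # a # xs) = of_int (sign ?t)"
    using assms by (intro tuple_sign_eq permutes_swap_id) auto
  then show ?thesis by (simp add: sign_swap_id)
qed

section \<open>Traces on invariant subspaces\<close>

interpretation fun_pair: vector_space_pair
  "fscale :: real \<Rightarrow> ('b \<Rightarrow> real) \<Rightarrow> 'b \<Rightarrow> real" "fscale :: real \<Rightarrow> ('c \<Rightarrow> real) \<Rightarrow> 'c \<Rightarrow> real"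
  by unfold_locales

abbreviation fun_linear :: "(('b \<Rightarrow> real) \<Rightarrow> ('c \<Rightarrow> real)) \<Rightarrow> bool" where
  "fun_linear \<equiv> Vector_Spaces.linear fscale fscale"

lemma fun_linearI:
  assumes "\<And>f g. A (f + g) = A f + A g" "\<And>c f. A (fscale c f) = fscale c (A f)"
  shows "fun_linear A"
  unfolding Vector_Spaces.linear_iff by (simp add: assms fun_space.vector_space_axioms)

text \<open>Finite dimension is expressed by the finite \<open>S\<close>: independent subsets of its
  span are finite, so a maximal independent extension of \<open>C\<close> inside \<open>W\<close> is
  a finite basis.\<close>

lemma obtain_finite_basis:
  assumes "fun_space.subspace W" "finite S" "W \<subseteq> fun_space.span S"
    and "fun_space.independent C" "C \<subseteq> W"
  obtains B where "C \<subseteq> B" "finite B" "fun_space.independent B" "fun_space.span B = W"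
proof -
  obtain B where B: "C \<subseteq> B" "B \<subseteq> W" "fun_space.independent B" "W \<subseteq> fun_space.span B"
    using fun_space.maximal_independent_subset_extend[OF assms(5,4)] by blast
  moreover have "finite B"
    using fun_space.independent_span_bound[OF assms(2) B(3)] B(2) assms(3) by blast
  moreover have "fun_space.span B = W"
    using B assms(1) by (metis fun_space.span_minimal subset_antisym)
  ultimately show ?thesis using that by blast
qed

text \<open>This is tr(PQ) = tr(QP): expanding \<open>b\<close> in \<open>C\<close> in one trace and
  \<open>A c\<close> in \<open>B\<close> in the other turns both into the same double sum.\<close>

lemma trace_independent_of_basis:
  assumes A: "fun_linear A" and inv: "\<And>w. w \<in> W \<Longrightarrow> A w \<in> W"
    and B: "fun_space.independent B" "fun_space.span B = W" "finite B"
    and C: "fun_space.independent C" "fun_space.span C = W" "finite C"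
  shows "(\<Sum>b\<in>B. fun_space.representation B (A b) b) = (\<Sum>c\<in>C. fun_space.representation C (A c) c)"
proof -
  let ?R = "fun_space.representation"
  have BW: "b \<in> W" if "b \<in> B" for b using that B fun_space.span_base by blast
  have CW: "c \<in> W" if "c \<in> C" for c using that C fun_space.span_base by blast
  have 1: "?R B (A b) b = (\<Sum>c\<in>C. ?R C b c * ?R B (A c) b)" if b: "b \<in> B" for b
  proof -
    have "A b = A (\<Sum>c\<in>C. fscale (?R C b c) c)"
      using fun_space.sum_representation_eq[OF C(1) _ C(3) order_refl, of b] BW[OF b] C by simp
    also have "\<dots> = (\<Sum>c\<in>C. fscale (?R C b c) (A c))"
      by (simp add: fun_pair.linear_sum[OF A] fun_pair.linear_scale[OF A])
    finally have "A b = (\<Sum>c\<in>C. fscale (?R C b c) (A c))" .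
    moreover have "?R B (\<Sum>c\<in>C. fscale (?R C b c) (A c)) = (\<lambda>d. \<Sum>c\<in>C. ?R B (fscale (?R C b c) (A c)) d)"
      using B inv CW by (intro fun_space.representation_sum) (auto intro: fun_space.span_scale)
    ultimately show ?thesis
      using B inv CW by (simp add: fun_space.representation_scale)
  qed
  have 2: "?R C (A c) c = (\<Sum>b\<in>B. ?R C b c * ?R B (A c) b)" if c: "c \<in> C" for c
  proof -
    have "A c = (\<Sum>b\<in>B. fscale (?R B (A c) b) b)"
      using fun_space.sum_representation_eq[OF B(1) _ B(3) order_refl, of "A c"] inv CW[OF c] B by simp
    moreover have "?R C (\<Sum>b\<in>B. fscale (?R B (A c) b) b) = (\<lambda>d. \<Sum>b\<in>B. ?R C (fscale (?R B (A c) b) b) d)"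
      using C BW by (intro fun_space.representation_sum) (auto intro: fun_space.span_scale)
    ultimately have "?R C (A c) c = (\<Sum>b\<in>B. ?R C (fscale (?R B (A c) b) b) c)"
      by metis
    then show ?thesis
      using C BW by (simp add: fun_space.representation_scale mult.commute)
  qed
  have "(\<Sum>b\<in>B. ?R B (A b) b) = (\<Sum>b\<in>B. \<Sum>c\<in>C. ?R C b c * ?R B (A c) b)"
    by (simp add: 1)
  also have "\<dots> = (\<Sum>c\<in>C. \<Sum>b\<in>B. ?R C b c * ?R B (A c) b)"
    by (rule sum.swap)
  also have "\<dots> = (\<Sum>c\<in>C. ?R C (A c) c)"
    by (simp add: 2)
  finally show ?thesis .
qed

text \<open>The basis chosen by \<open>SOME\<close> is finite, being independent in the span of the
  finite \<open>C\<close>, so basis independence applies to it and \<open>C\<close>.\<close>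

lemma trace_on_eq:
  assumes A: "fun_linear A" and inv: "\<And>w. w \<in> W \<Longrightarrow> A w \<in> W"
    and C: "fun_space.independent C" "fun_space.span C = W" "finite C"
  shows "trace_on W A = (\<Sum>c\<in>C. fun_space.representation C (A c) c)"
proof -
  define B where "B = (SOME B. fun_space.independent B \<and> fun_space.span B = W)"
  have B: "fun_space.independent B \<and> fun_space.span B = W"
    unfolding B_def by (rule someI[where x = C]) (use C in simp)
  then have "finite B"
    using fun_space.independent_span_bound[OF C(3)] C(2) fun_space.span_superset by metis
  then show ?thesis
    unfolding trace_on_def Let_def B_def[symmetric]
    using B C by (intro trace_independent_of_basis[OF A inv]) auto
qed

text \<open>An independent set does not contain 0, so the only basis that \<open>SOME\<close> can
  choose is empty.\<close>

lemma trace_on_zero: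
  fixes A :: "('b \<Rightarrow> real) \<Rightarrow> 'b \<Rightarrow> real"
  shows "trace_on {0} A = 0"
proof -
  have B: "B = {}" if "fun_space.independent B" "fun_space.span B = {0}" for B :: "('b \<Rightarrow> real) set"
  proof -
    have "0 \<notin> B" using that(1) fun_space.dependent_zero by blast
    moreover have "B \<subseteq> {0}" using fun_space.span_superset[of B] that(2) by simp
    ultimately show ?thesis by auto
  qed
  have "(SOME B. fun_space.independent B \<and> fun_space.span B = {0}) = ({} :: ('b \<Rightarrow> real) set)"
    using B by (intro some_equality) (auto simp: fun_space.independent_empty fun_space.span_empty)
  then show ?thesis by (simp add: trace_on_def)
qed

text \<open>
  Extend a basis of the kernel of \<open>D\<close> to a basis of \<open>W\<close>: \<open>D\<close> maps the added vectors to a basis of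
  the image, and preserves their diagonal coefficients.
\<close>
lemma trace_on_kernel_image:
  assumes A: "fun_linear A" and D: "fun_linear D"
    and W: "fun_space.subspace W" "finite S" "W \<subseteq> fun_space.span S"
    and inv: "\<And>w. w \<in> W \<Longrightarrow> A w \<in> W"
    and comm: "\<And>w. w \<in> W \<Longrightarrow> A (D w) = D (A w)"
  shows "trace_on W A = trace_on {w \<in> W. D w = 0} A + trace_on (D ` W) A"
proof -
  let ?R = "fun_space.representation" and ?K = "{w \<in> W. D w = 0}"
  have K: "fun_space.subspace ?K"
    using W(1) unfolding fun_space.subspace_def
    by (auto simp: fun_pair.linear_0[OF D] fun_pair.linear_add[OF D] fun_pair.linear_scale[OF D]
        fun_space.scale_zero_right)
  obtain B1 where B1: "finite B1" "fun_space.independent B1" "fun_space.span B1 = ?K"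
    using obtain_finite_basis[OF K W(2) _ fun_space.independent_empty] W(3)
    by (metis (no_types, lifting) empty_subsetI mem_Collect_eq subset_iff)
  have B1W: "B1 \<subseteq> W" using B1 fun_space.span_superset by blast
  obtain B where B: "B1 \<subseteq> B" "finite B" "fun_space.independent B" "fun_space.span B = W"
    using obtain_finite_basis[OF W B1(2) B1W] by blast
  define C where "C = B - B1"
  have C: "finite C" "C \<subseteq> B" "B1 \<inter> C = {}" "fun_space.independent C"
    using B fun_space.independent_mono[OF B(3), of "B - B1"] by (auto simp: C_def)
  have BW: "b \<in> W" if "b \<in> B" for b using that B fun_space.span_base by blast
  have D0: "D b = 0" if "b \<in> B1" for b using that B1 fun_space.span_base by blast
  \<comment> \<open>A kernel vector in the span of \<open>C\<close> lies also in the span of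
    \<open>B1\<close>. By uniqueness of coordinates in \<open>B\<close>, its support lies in both of
    these disjoint sets.\<close>
  have "\<forall>v\<in>fun_space.span C. D v = 0 \<longrightarrow> v = 0"
  proof (intro ballI impI)
    fix v assume v: "v \<in> fun_space.span C" "D v = 0"
    have vB: "v \<in> fun_space.span B" using v fun_space.span_mono[OF C(2)] by blast
    with v have v1: "v \<in> fun_space.span B1" using B1 B by auto
    have "?R B v b = 0" for b
      using fun_space.representation_extend[OF B(3) v(1) C(2)]
        fun_space.representation_extend[OF B(3) v1 B(1)] C(3) fun_space.representation_ne_zero
      by (metis disjoint_iff)
    then show "v = 0"
      using fun_space.sum_representation_eq[OF B(3) vB B(2) order_refl]
      by (simp add: fun_space.scale_zero_left)
  qed
  then have injS: "inj_on D (fun_space.span C)"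
    by (simp add: fun_pair.linear_inj_on_iff_eq_0[OF D fun_space.subspace_span])
  then have inj: "inj_on D C" using fun_space.span_superset inj_on_subset by metis
  have indD: "fun_space.independent (D ` C)"
    by (rule fun_pair.linear_independent_injective_image[OF D C(4) injS])
  \<comment> \<open>\<open>D\<close> kills \<open>B1\<close>, so only the coordinates along
    \<open>C\<close> survive.\<close>
  have D_exp: "D w = (\<Sum>c\<in>C. fscale (?R B w c) (D c))" if "w \<in> W" for w
  proof -
    have "D w = D (\<Sum>b\<in>B. fscale (?R B w b) b)"
      using fun_space.sum_representation_eq[OF B(3) _ B(2) order_refl, of w] that B by simp
    also have "\<dots> = (\<Sum>b\<in>B. fscale (?R B w b) (D b))"
      by (simp add: fun_pair.linear_sum[OF D] fun_pair.linear_scale[OF D])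
    also have "\<dots> = (\<Sum>c\<in>C. fscale (?R B w c) (D c))"
      using B(2) D0
      by (intro sum.mono_neutral_right) (auto simp: fun_space.scale_zero_right C_def)
    finally show ?thesis .
  qed
  have spanD: "fun_space.span (D ` C) = D ` W"
  proof
    show "fun_space.span (D ` C) \<subseteq> D ` W"
      unfolding fun_pair.linear_span_image[OF D] B(4)[symmetric]
      by (intro image_mono fun_space.span_mono C(2))
    show "D ` W \<subseteq> fun_space.span (D ` C)"
    proof
      fix u assume "u \<in> D ` W"
      then obtain w where "w \<in> W" "u = D w" by blast
      then have u: "u = (\<Sum>c\<in>C. fscale (?R B w c) (D c))" by (simp only: D_exp)
      show "u \<in> fun_space.span (D ` C)"
        unfolding u by (intro fun_space.span_sum fun_space.span_scale fun_space.span_base imageI)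
    qed
  qed
  \<comment> \<open>By the expansion applied to \<open>A c\<close>, the coordinates of
    \<open>A c\<close> along \<open>C\<close> become the coordinates of \<open>D (A c)\<close> in
    the image of \<open>C\<close>.\<close>
  have repD: "?R (D ` C) (D (A c)) (D c) = ?R B (A c) c" if c: "c \<in> C" for c
  proof -
    have AW: "A e \<in> W" if "e \<in> C" for e using inv BW C that by blast
    have "?R (D ` C) (D (A c)) = (\<lambda>d. \<Sum>e\<in>C. ?R (D ` C) (fscale (?R B (A c) e) (D e)) d)"
      unfolding D_exp[OF AW[OF c]] using indD
      by (intro fun_space.representation_sum)
         (auto intro: fun_space.span_scale fun_space.span_base)
    then have "?R (D ` C) (D (A c)) (D c) = (\<Sum>e\<in>C. ?R (D ` C) (fscale (?R B (A c) e) (D e)) (D c))"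
      by simp
    also have "\<dots> = (\<Sum>e\<in>C. ?R B (A c) e * (if D c = D e then 1 else 0))"
      using indD by (intro sum.cong refl)
        (simp add: fun_space.representation_scale fun_space.span_base fun_space.representation_basis)
    also have "\<dots> = (\<Sum>e\<in>C. if e = c then ?R B (A c) e else 0)"
      using inj c by (intro sum.cong) (auto simp: inj_on_eq_iff)
    also have "\<dots> = ?R B (A c) c" using C(1) c by simp
    finally show ?thesis .
  qed
  have "trace_on W A = (\<Sum>b\<in>B. ?R B (A b) b)"
    by (rule trace_on_eq[OF A inv B(3,4,2)])
  also have "\<dots> = (\<Sum>b\<in>B1. ?R B (A b) b) + (\<Sum>c\<in>C. ?R B (A c) c)"
    unfolding C_def by (subst sum.subset_diff[OF B(1,2)]) (rule add.commute)
  \<comment> \<open>The kernel is invariant under \<open>A\<close>, so \<open>A b\<close> already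
    expands in \<open>B1\<close>, with the same coordinates as in \<open>B\<close>.\<close>
  also have "(\<Sum>b\<in>B1. ?R B (A b) b) = (\<Sum>b\<in>B1. ?R B1 (A b) b)"
  proof (rule sum.cong[OF refl])
    fix b assume b: "b \<in> B1"
    then have "A b \<in> ?K"
      using inv comm[of b] BW B D0 by (auto simp: fun_pair.linear_0[OF A])
    then show "?R B (A b) b = ?R B1 (A b) b"
      using fun_space.representation_extend[OF B(3) _ B(1)] B1 by simp
  qed
  also have "\<dots> = trace_on ?K A"
    using inv comm by (intro trace_on_eq[OF A _ B1(2,3,1), symmetric])
      (auto simp: fun_pair.linear_0[OF A] dest: comm[symmetric])
  also have "(\<Sum>c\<in>C. ?R B (A c) c) = (\<Sum>c\<in>C. ?R (D ` C) (A (D c)) (D c))"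
    using repD comm BW C(2) by (intro sum.cong) auto
  also have "\<dots> = (\<Sum>d\<in>D ` C. ?R (D ` C) (A d) d)"
    by (simp add: sum.reindex[OF inj])
  also have "\<dots> = trace_on (D ` W) A"
    using inv comm C(1) by (intro trace_on_eq[OF A _ indD spanD, symmetric]) auto
  finally show ?thesis .
qed

text \<open>The image of a basis is independent, lies in \<open>W\<close> and has the size of a
  basis, so extending it to a basis adds nothing.\<close>

lemma injective_endomorphism_surjective:
  assumes L: "fun_linear L"
    and W: "fun_space.subspace W" "finite S" "W \<subseteq> fun_space.span S"
    and inv: "\<And>w. w \<in> W \<Longrightarrow> L w \<in> W"
    and ker: "\<And>w. w \<in> W \<Longrightarrow> L w = 0 \<Longrightarrow> w = 0"
  shows "L ` W = W"
proof -
  obtain B where B: "finite B" "fun_space.independent B" "fun_space.span B = W"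
    using obtain_finite_basis[OF W, of "{}"] fun_space.independent_empty by blast
  have "inj_on L W"
    using ker by (simp add: fun_pair.linear_inj_on_iff_eq_0[OF L W(1)])
  then have inj: "inj_on L (fun_space.span B)" by (simp only: B(3))
  then have "inj_on L B" using fun_space.span_superset inj_on_subset by metis
  then have card: "card (L ` B) = card B" by (rule card_image)
  have ind: "fun_space.independent (L ` B)"
    by (rule fun_pair.linear_independent_injective_image[OF L B(2) inj])
  have sub: "L ` B \<subseteq> W"
    using B inv fun_space.span_superset by blast
  obtain B' where B': "L ` B \<subseteq> B'" "finite B'" "fun_space.independent B'" "fun_space.span B' = W"
    using obtain_finite_basis[OF W ind sub] by blast
  have "card B' = card B"
    using B B' fun_space.dim_span_eq_card_independent by metis
  then have "L ` B = B'"
    using B' card card_subset_eq by metis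
  then show ?thesis
    using fun_pair.linear_span_image[OF L, of B] B B' by simp
qed

section \<open>Point masses and traces on spaces of forms\<close>

lemma sum_fun_apply: "(\<Sum>i\<in>I. F i) x = (\<Sum>i\<in>I. F i x)"
  by (induction I rule: infinite_finite_induct) auto

definition delta :: "'b \<Rightarrow> 'b \<Rightarrow> real" where
  "delta x = (\<lambda>y. if y = x then 1 else 0)"

lemma inj_delta: "inj delta"
  by (rule injI) (metis delta_def zero_neq_one)

lemma sum_delta_apply:
  assumes "finite S"
  shows "(\<Sum>b\<in>delta ` S. fscale (c b) b) x = (if x \<in> S then c (delta x) else 0)"
proof -
  have "(\<Sum>b\<in>delta ` S. fscale (c b) b) x = (\<Sum>y\<in>S. c (delta y) * delta y x)"
    by (subst sum.reindex) (auto simp: inj_on_subset[OF inj_delta] sum_fun_apply fscale_def)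
  also have "\<dots> = (\<Sum>y\<in>S. if y = x then c (delta y) else 0)"
    by (intro sum.cong) (auto simp: delta_def)
  also have "\<dots> = (if x \<in> S then c (delta x) else 0)"
    using assms by simp
  finally show ?thesis .
qed

lemma independent_delta:
  assumes "finite S"
  shows "fun_space.independent (delta ` S)"
proof (rule fun_space.independent_if_scalars_zero)
  fix c b
  assume 0: "(\<Sum>b\<in>delta ` S. fscale (c b) b) = 0" and "b \<in> delta ` S"
  then obtain x where "x \<in> S" "b = delta x" by blast
  then show "c b = 0"
    using sum_delta_apply[OF assms, of c x] 0 by simp
qed (use assms in simp)

lemma subspace_forms: "fun_space.subspace (forms S)"
  by (auto simp: fun_space.subspace_def forms_def fscale_def)

lemma span_delta:
  assumes "finite S"
  shows "fun_space.span (delta ` S) = forms S"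
proof
  show "fun_space.span (delta ` S) \<subseteq> forms S"
    by (rule fun_space.span_minimal[OF _ subspace_forms]) (auto simp: forms_def delta_def)
  show "forms S \<subseteq> fun_space.span (delta ` S)"
  proof
    fix f assume f: "f \<in> forms S"
    \<comment> \<open>The coefficient of \<open>delta x\<close> is \<open>f x\<close>; since
      coefficients are indexed by basis vectors, \<open>inv delta\<close> recovers
      \<open>x\<close>.\<close>
    have "f = (\<Sum>b\<in>delta ` S. fscale (f (inv delta b)) b)"
      using f by (auto simp: fun_eq_iff sum_delta_apply[OF assms] inv_f_f[OF inj_delta] forms_def)
    then show "f \<in> fun_space.span (delta ` S)"
      by (metis (no_types, lifting) fun_space.span_base fun_space.span_scale fun_space.span_sum)
  qed
qed

text \<open>In the basis of point masses, the coordinate of a form along \<open>delta x\<close> is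
  its value at \<open>x\<close>.\<close>

lemma trace_on_forms:
  assumes "finite S" "fun_linear A" "\<And>f. f \<in> forms S \<Longrightarrow> A f \<in> forms S"
  shows "trace_on (forms S) A = (\<Sum>x\<in>S. A (delta x) x)"
proof -
  let ?B = "delta ` S"
  have rep: "fun_space.representation ?B f (delta x) = f x" if "f \<in> forms S" "x \<in> S" for f x
  proof -
    have "(\<Sum>b\<in>?B. fscale (fun_space.representation ?B f b) b) = f"
      using assms(1) that
      by (intro fun_space.sum_representation_eq) (auto simp: independent_delta span_delta)
    then show ?thesis
      using sum_delta_apply[OF assms(1), of "fun_space.representation ?B f" x] that by simp
  qed
  have "trace_on (forms S) A = (\<Sum>b\<in>?B. fun_space.representation ?B (A b) b)"
    using assms by (intro trace_on_eq) (auto simp: independent_delta span_delta)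
  also have "\<dots> = (\<Sum>x\<in>S. fun_space.representation ?B (A (delta x)) (delta x))"
    by (simp add: sum.reindex inj_on_subset[OF inj_delta])
  also have "\<dots> = (\<Sum>x\<in>S. A (delta x) x)"
    using assms(3) by (intro sum.cong refl rep) (auto simp: forms_def delta_def)
  finally show ?thesis .
qed

section \<open>Hodge theory of an oriented complex\<close>

locale oriented_complex =
  fixes G :: "'a set set" and ord :: "'a set \<Rightarrow> 'a list"
  assumes complex: "simplicial_complex G" and ordering: "vertex_ordering G ord"
begin

definition facets :: "'a set \<Rightarrow> 'a set set" where
  "facets x = {y \<in> G. y \<subset> x \<and> sdim x = sdim y + 1}"

definition cofacets :: "'a set \<Rightarrow> 'a set set" where
  "cofacets y = {x \<in> G. y \<subset> x \<and> sdim x = sdim y + 1}"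

abbreviation d :: "('a set \<Rightarrow> real) \<Rightarrow> ('a set \<Rightarrow> real)" where
  "d \<equiv> ext_deriv G ord"

text \<open>The transposed incidence matrix: an explicit formula for the adjoint of
  \<open>d\<close>, which \<open>form_adjoint\<close> specifies only by a choice.\<close>

definition coderiv :: "('a set \<Rightarrow> real) \<Rightarrow> ('a set \<Rightarrow> real)" where
  "coderiv g = (\<lambda>y. if y \<in> G then \<Sum>x\<in>cofacets y. face_sign ord x y * g x else 0)"

lemma finite_complex: "finite G"
  and simplex_finite: "x \<in> G \<Longrightarrow> finite x"
  and simplex_nonempty: "x \<in> G \<Longrightarrow> x \<noteq> {}"
  and face_closed: "x \<in> G \<Longrightarrow> y \<subseteq> x \<Longrightarrow> y \<noteq> {} \<Longrightarrow> y \<in> G"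
  using complex unfolding simplicial_complex_def by blast+

lemma ord_distinct: "x \<in> G \<Longrightarrow> distinct (ord x)"
  and ord_set: "x \<in> G \<Longrightarrow> set (ord x) = x"
  using ordering by (auto simp: vertex_ordering_def)

lemma card_simplex: "x \<in> G \<Longrightarrow> card x = Suc (sdim x)"
  using simplex_finite[of x] simplex_nonempty[of x] by (simp add: sdim_def card_gt_0_iff)

lemma ext_deriv_eq: "d f x = (if x \<in> G then \<Sum>y\<in>facets x. face_sign ord x y * f y else 0)"
  by (simp add: ext_deriv_def facets_def)

section \<open>Facets and incidence signs\<close>

lemma facetE:
  assumes "x \<in> G" "y \<in> facets x"
  obtains v where "v \<notin> y" "x = insert v y" "y \<in> G"
proof -
  have y: "y \<in> G" "y \<subset> x" "sdim x = sdim y + 1" using assms(2) by (auto simp: facets_def)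
  then have "card (x - y) = 1"
    using assms(1) simplex_finite by (simp add: card_Diff_subset psubset_imp_subset card_simplex)
  then obtain v where "x - y = {v}" by (auto simp: card_Suc_eq)
  then show ?thesis using that[of v] y by blast
qed

lemma facet_insert:
  assumes "insert v y \<in> G" "y \<noteq> {}" "v \<notin> y"
  shows "y \<in> facets (insert v y)"
proof -
  have y: "y \<in> G" using face_closed[OF assms(1)] assms(2) by blast
  then have "card (insert v y) = Suc (card y)" using simplex_finite assms(3) by simp
  then show ?thesis
    using y assms by (auto simp: facets_def card_simplex)
qed

lemma face_sign_insert:
  "v \<notin> y \<Longrightarrow> face_sign ord (insert v y) y = tuple_sign (v # ord y) (ord (insert v y))"
  by (simp add: face_sign_def insert_Diff_if)

text \<open>Prepending \<open>v\<close> to both tuples in the sign of \<open>z\<close> in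
  \<open>insert w z\<close> makes the two signs composable.\<close>

lemma face_sign_face_sign:
  assumes G: "insert v (insert w z) \<in> G" "z \<in> G" and vw: "v \<notin> insert w z" "w \<notin> z"
  shows "face_sign ord (insert v (insert w z)) (insert w z) * face_sign ord (insert w z) z =
    tuple_sign (v # w # ord z) (ord (insert v (insert w z)))"
proof -
  let ?y = "insert w z" and ?x = "insert v (insert w z)"
  have y: "?y \<in> G" using face_closed[OF G(1), of ?y] by blast
  note s = ord_distinct[OF G(2)] ord_set[OF G(2)] ord_distinct[OF y] ord_set[OF y]
    ord_distinct[OF G(1)] ord_set[OF G(1)]
  have "face_sign ord ?y z = tuple_sign (v # w # ord z) (v # ord ?y)"
    using s vw by (subst tuple_sign_Cons) (auto simp: face_sign_insert)
  then show ?thesis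
    using s vw tuple_sign_trans[of "v # w # ord z" "v # ord ?y" "ord ?x"]
    by (simp add: face_sign_insert mult.commute)
qed

text \<open>Both products compare a tuple starting with \<open>v\<close> and \<open>w\<close>, in
  one of the two orders, to the same ordered simplex; one transposition separates them.\<close>

lemma face_sign_swap:
  assumes G: "insert v (insert w z) \<in> G" "z \<in> G" and vw: "v \<notin> insert w z" "w \<notin> z"
  shows "face_sign ord (insert v (insert w z)) (insert w z) * face_sign ord (insert w z) z =
    - (face_sign ord (insert v (insert w z)) (insert v z) * face_sign ord (insert v z) z)"
proof -
  let ?x = "insert v (insert w z)"
  have x: "insert w (insert v z) = ?x" by blast
  note s = ord_distinct[OF G(2)] ord_set[OF G(2)] ord_distinct[OF G(1)] ord_set[OF G(1)]
  have "tuple_sign (v # w # ord z) (ord ?x) =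
    tuple_sign (v # w # ord z) (w # v # ord z) * tuple_sign (w # v # ord z) (ord ?x)"
    using s vw by (subst tuple_sign_trans) auto
  also have "\<dots> = - tuple_sign (w # v # ord z) (ord ?x)"
    using s vw by (subst tuple_sign_swap) auto
  finally show ?thesis
    using face_sign_face_sign[OF G vw] face_sign_face_sign[of w v z] G vw x by auto
qed

lemma ext_deriv_ext_deriv: "d (d f) = 0"
proof
  fix x
  show "d (d f) x = 0 x"
  proof (cases "x \<in> G")
    case x: True
    \<comment> \<open>A codimension 2 face \<open>z\<close> of \<open>x\<close> lies in exactly two facets, which \<open>?swap\<close> exchanges.\<close>
    let ?P = "SIGMA y:facets x. facets y"
    let ?t = "\<lambda>(y, z). face_sign ord x y * face_sign ord y z * f z"
    let ?swap = "\<lambda>(y, z). (x - (y - z), z)"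
    have fin: "finite (facets y)" for y
      using finite_complex by (simp add: facets_def)
    have swap: "?swap p \<in> ?P \<and> ?swap (?swap p) = p \<and> ?t (?swap p) = - ?t p" if pP: "p \<in> ?P" for p
    proof -
      obtain y z where p: "p = (y, z)" "y \<in> facets x" "z \<in> facets y"
        using pP by blast
      obtain v where v: "v \<notin> y" "x = insert v y" "y \<in> G" by (rule facetE[OF x p(2)])
      obtain w where w: "w \<notin> z" "y = insert w z" "z \<in> G" by (rule facetE[OF v(3) p(3)])
      have xv: "x = insert w (insert v z)" using v w by blast
      have y': "x - (y - z) = insert v z" using v w by blast
      have z: "z \<noteq> {}" using w simplex_nonempty by blast
      have vz: "insert v z \<in> G" using face_closed[OF x] xv by blast
      have "insert v z \<in> facets x"
        unfolding xv using x xv v w by (intro facet_insert) auto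
      moreover have "z \<in> facets (insert v z)"
        using vz z v w by (intro facet_insert) auto
      moreover have "x - (insert v z - z) = y" using v w by blast
      moreover have "face_sign ord x y * face_sign ord y z =
          - (face_sign ord x (insert v z) * face_sign ord (insert v z) z)"
        using face_sign_swap[of v w z] x v w by blast
      ultimately show ?thesis by (simp add: p(1) y')
    qed
    have "d (d f) x = (\<Sum>y\<in>facets x. \<Sum>z\<in>facets y. face_sign ord x y * face_sign ord y z * f z)"
      using x by (auto simp: ext_deriv_eq sum_distrib_left mult.assoc facets_def intro!: sum.cong)
    also have "\<dots> = sum ?t ?P"
      using fin by (subst sum.Sigma) auto
    finally have 1: "d (d f) x = sum ?t ?P" .
    \<comment> \<open>Reindexing by the sign-reversing involution makes the sum equal to its own
      negative.\<close>
    have "sum ?t ?P = (\<Sum>p\<in>?P. - ?t p)"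
      using swap by (intro sum.reindex_bij_witness[of _ ?swap ?swap]) auto
    then have "sum ?t ?P = - sum ?t ?P" by (simp add: sum_negf)
    with 1 show ?thesis by simp
  qed (simp add: ext_deriv_eq)
qed

section \<open>The adjoint of \<open>d\<close> and the kernel of the Laplacian\<close>

lemma linear_ext_deriv: "fun_linear d"
  by (rule fun_linearI)
    (auto simp: fun_eq_iff ext_deriv_eq fscale_def sum.distrib sum_distrib_left algebra_simps)

lemma linear_coderiv: "fun_linear coderiv"
  by (rule fun_linearI)
    (auto simp: fun_eq_iff coderiv_def fscale_def sum.distrib sum_distrib_left algebra_simps)

text \<open>Both sides are the same sum over incident pairs, taken in opposite orders of
  summation.\<close>

lemma ext_deriv_coderiv_adjoint: "form_inner G (d f) g = form_inner G f (coderiv g)"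
proof -
  have "form_inner G (d f) g =
      (\<Sum>x\<in>G. \<Sum>y | y \<in> G \<and> (y \<subset> x \<and> sdim x = sdim y + 1). face_sign ord x y * f y * g x)"
    by (simp add: form_inner_def ext_deriv_eq facets_def sum_distrib_right)
  also have "\<dots> =
      (\<Sum>y\<in>G. \<Sum>x | x \<in> G \<and> (y \<subset> x \<and> sdim x = sdim y + 1). face_sign ord x y * f y * g x)"
    by (rule sum.swap_restrict[OF finite_complex finite_complex])
  also have "\<dots> = form_inner G f (coderiv g)"
    by (simp add: form_inner_def coderiv_def cofacets_def sum_distrib_left mult_ac)
  finally show ?thesis .
qed

lemma form_inner_self_eq_0: "f \<in> forms G \<Longrightarrow> form_inner G f f = 0 \<Longrightarrow> f = 0"
  using finite_complex by (auto simp: form_inner_def forms_def sum_nonneg_eq_0_iff fun_eq_iff)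

lemma form_inner_add_left: "form_inner G (f + g) h = form_inner G f h + form_inner G g h"
  and form_inner_diff_right: "form_inner G h (f - g) = form_inner G h f - form_inner G h g"
  and form_inner_commute: "form_inner G f g = form_inner G g f"
  and form_inner_0_left: "form_inner G 0 g = 0"
  by (simp_all add: form_inner_def algebra_simps sum.distrib sum_subtractf)

lemma ext_deriv_forms: "d f \<in> forms G"
  by (simp add: forms_def ext_deriv_eq)

lemma coderiv_forms: "coderiv f \<in> forms G"
  by (simp add: forms_def coderiv_def)

text \<open>\<open>coderiv\<close> witnesses that an adjoint exists, and definiteness of the inner
  product makes it unique on \<open>forms G\<close>.\<close>

lemma form_adjoint_ext_deriv:
  assumes g: "g \<in> forms G"
  shows "form_adjoint G d g = coderiv g"
proof -
  define P where "P A' \<longleftrightarrow> (\<forall>g\<in>forms G. A' g \<in> forms G) \<and>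
       (\<forall>f\<in>forms G. \<forall>g\<in>forms G. form_inner G (d f) g = form_inner G f (A' g))" for A'
  have "P coderiv" unfolding P_def using coderiv_forms ext_deriv_coderiv_adjoint by blast
  then have "P (form_adjoint G d)" unfolding form_adjoint_def P_def[symmetric] by (rule someI[of P])
  then have adj: "form_adjoint G d g \<in> forms G"
    "\<And>f. f \<in> forms G \<Longrightarrow> form_inner G f (form_adjoint G d g) = form_inner G f (coderiv g)"
    using g ext_deriv_coderiv_adjoint by (auto simp: P_def)
  \<comment> \<open>Testing both adjoints against their difference makes the norm of the difference
    vanish.\<close>
  let ?h = "form_adjoint G d g - coderiv g"
  have h: "?h \<in> forms G"
    using adj(1) coderiv_forms fun_space.subspace_diff[OF subspace_forms] by blast
  have "form_inner G ?h ?h = form_inner G ?h (form_adjoint G d g) - form_inner G ?h (coderiv g)"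
    by (rule form_inner_diff_right)
  also have "\<dots> = 0" using adj(2)[OF h] by simp
  finally have "?h = 0" by (rule form_inner_self_eq_0[OF h])
  then show ?thesis by simp
qed

text \<open>Moving \<open>coderiv\<close> twice across the inner product in the squared norm
  produces \<open>d\<close> applied twice, which is zero.\<close>

lemma coderiv_coderiv: "coderiv (coderiv f) = 0"
proof (rule form_inner_self_eq_0[OF coderiv_forms])
  show "form_inner G (coderiv (coderiv f)) (coderiv (coderiv f)) = 0"
    by (metis ext_deriv_coderiv_adjoint ext_deriv_ext_deriv form_inner_0_left)
qed

lemma hodge_laplacian_eq:
  assumes f: "f \<in> forms G"
  shows "hodge_laplacian G ord f = d (coderiv f) + coderiv (d f)"
proof -
  have D: "dirac G ord g = d g + coderiv g" if "g \<in> forms G" for g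
    using form_adjoint_ext_deriv[OF that] by (simp add: dirac_def)
  have "d f + coderiv f \<in> forms G"
    using ext_deriv_forms coderiv_forms fun_space.subspace_add[OF subspace_forms] by blast
  then show ?thesis
    by (simp add: hodge_laplacian_def D f fun_pair.linear_add[OF linear_ext_deriv]
        fun_pair.linear_add[OF linear_coderiv] ext_deriv_ext_deriv coderiv_coderiv)
qed

text \<open>The squared norm of \<open>coderiv f\<close> is the inner product of
  \<open>d (coderiv f)\<close> with \<open>f\<close>.\<close>

lemma ext_deriv_coderiv_eq_0:
  assumes "d (coderiv f) = 0"
  shows "coderiv f = 0"
  using ext_deriv_coderiv_adjoint[of "coderiv f" f] assms form_inner_0_left
    form_inner_self_eq_0[OF coderiv_forms] by metis

text \<open>The inner product of the Laplacian of \<open>f\<close> with \<open>f\<close> is the sum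
  of the squared norms of \<open>d f\<close> and \<open>coderiv f\<close>. The second condition
  keeps the outer \<open>d\<close>, so that harmonic forms become the kernel of an operator
  preserving the closed forms.\<close>

lemma hodge_laplacian_eq_0_iff:
  assumes f: "f \<in> forms G"
  shows "hodge_laplacian G ord f = 0 \<longleftrightarrow> d f = 0 \<and> d (coderiv f) = 0"
proof
  assume "hodge_laplacian G ord f = 0"
  then have "form_inner G (d (coderiv f)) f + form_inner G (coderiv (d f)) f = 0"
    using hodge_laplacian_eq[OF f] form_inner_add_left form_inner_0_left by metis
  then have "form_inner G (coderiv f) (coderiv f) + form_inner G (d f) (d f) = 0"
    using ext_deriv_coderiv_adjoint form_inner_commute by metis
  moreover have "form_inner G h h \<ge> 0" for h
    by (simp add: form_inner_def sum_nonneg)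
  ultimately have "form_inner G (coderiv f) (coderiv f) = 0" "form_inner G (d f) (d f) = 0"
    by (meson add_nonneg_eq_0_iff)+
  then show "d f = 0 \<and> d (coderiv f) = 0"
    using form_inner_self_eq_0 coderiv_forms ext_deriv_forms fun_pair.linear_0[OF linear_ext_deriv]
    by metis
next
  assume "d f = 0 \<and> d (coderiv f) = 0"
  then show "hodge_laplacian G ord f = 0"
    using hodge_laplacian_eq[OF f] fun_pair.linear_0[OF linear_coderiv] by simp
qed

section \<open>Closed, exact and harmonic forms\<close>

text \<open>The forms of degree \<open>k - 1\<close>; only the zero form if \<open>k = 0\<close>.\<close>
definition pred_forms :: "nat \<Rightarrow> ('a set \<Rightarrow> real) set" where
  "pred_forms k = forms {x \<in> G. Suc (sdim x) = k}"

definition closed_forms :: "nat \<Rightarrow> ('a set \<Rightarrow> real) set" where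
  "closed_forms k = {f \<in> k_forms G k. d f = 0}"

definition exact_forms :: "nat \<Rightarrow> ('a set \<Rightarrow> real) set" where
  "exact_forms k = d ` pred_forms k"

lemma ext_deriv_pred_forms: "f \<in> pred_forms k \<Longrightarrow> d f \<in> k_forms G k"
  by (auto simp: pred_forms_def k_forms_def forms_def ext_deriv_eq facets_def intro!: sum.neutral)

lemma coderiv_k_forms: "f \<in> k_forms G k \<Longrightarrow> coderiv f \<in> pred_forms k"
  by (auto simp: pred_forms_def k_forms_def forms_def coderiv_def cofacets_def intro!: sum.neutral)

lemma k_forms_subset_forms: "k_forms G k \<subseteq> forms G"
  by (auto simp: k_forms_def forms_def)

lemma pred_forms_0: "pred_forms 0 = {0}"
  by (auto simp: pred_forms_def forms_def)

lemma pred_forms_Suc: "pred_forms (Suc k) = k_forms G k"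
  by (simp add: pred_forms_def k_forms_def)

lemma exact_subset_closed: "exact_forms k \<subseteq> closed_forms k"
  using ext_deriv_pred_forms ext_deriv_ext_deriv by (auto simp: exact_forms_def closed_forms_def)

lemma subspace_closed_forms: "fun_space.subspace (closed_forms k)"
  using subspace_forms[of "{x \<in> G. sdim x = k}"]
  unfolding closed_forms_def k_forms_def fun_space.subspace_def
  by (simp add: fun_pair.linear_0[OF linear_ext_deriv] fun_pair.linear_add[OF linear_ext_deriv]
      fun_pair.linear_scale[OF linear_ext_deriv])

lemma subspace_exact_forms: "fun_space.subspace (exact_forms k)"
  unfolding exact_forms_def pred_forms_def
  by (rule fun_pair.linear_subspace_image[OF linear_ext_deriv subspace_forms])

lemma k_forms_subset_span: "k_forms G k \<subseteq> fun_space.span (delta ` {x \<in> G. sdim x = k})"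
  using finite_complex by (simp add: span_delta k_forms_def)

lemma linear_d_coderiv: "fun_linear (\<lambda>f. d (coderiv f))"
  using Vector_Spaces.linear_compose[OF linear_coderiv linear_ext_deriv] by (simp add: o_def)

lemma harmonic_forms_eq: "harmonic_forms G ord k = {f \<in> closed_forms k. d (coderiv f) = 0}"
  using k_forms_subset_forms hodge_laplacian_eq_0_iff
  by (auto simp: harmonic_forms_def closed_forms_def)

text \<open>
  The composition \<open>d d\<^sup>*\<close> is injective, hence bijective, on the exact forms. This replaces the
  orthogonal decomposition of the closed forms.
\<close>
lemma d_coderiv_closed_forms: "(\<lambda>f. d (coderiv f)) ` closed_forms k = exact_forms k"
proof -
  have sub: "(\<lambda>f. d (coderiv f)) ` closed_forms k \<subseteq> exact_forms k"
    using coderiv_k_forms by (auto simp: closed_forms_def exact_forms_def)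
  have "(\<lambda>f. d (coderiv f)) ` exact_forms k = exact_forms k"
  proof (rule injective_endomorphism_surjective[OF linear_d_coderiv subspace_exact_forms])
    show "finite (delta ` {x \<in> G. sdim x = k})" using finite_complex by simp
    show "exact_forms k \<subseteq> fun_space.span (delta ` {x \<in> G. sdim x = k})"
      using exact_subset_closed k_forms_subset_span by (force simp: closed_forms_def)
    show "d (coderiv w) \<in> exact_forms k" if "w \<in> exact_forms k" for w
      using that sub exact_subset_closed by blast
    show "w = 0" if w: "w \<in> exact_forms k" "d (coderiv w) = 0" for w
    proof -
      obtain g where g: "w = d g" using w(1) by (auto simp: exact_forms_def)
      \<comment> \<open>The kernel condition forces \<open>coderiv w = 0\<close>, so the exact form
        \<open>w\<close> is orthogonal to itself.\<close>
      have "form_inner G w w = form_inner G g (coderiv w)"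
        using g ext_deriv_coderiv_adjoint by metis
      also have "\<dots> = 0"
        using ext_deriv_coderiv_eq_0[OF w(2)] form_inner_commute form_inner_0_left by metis
      finally show "w = 0"
        using form_inner_self_eq_0 ext_deriv_forms g by metis
    qed
  qed
  \<comment> \<open>The exact forms are closed and already map onto all exact forms, so the image of
    the closed forms is squeezed between equal spaces.\<close>
  then show ?thesis using sub exact_subset_closed by blast
qed

end

section \<open>Automorphisms\<close>

locale complex_automorphism = oriented_complex G ord
  for G :: "'a set set" and ord :: "'a set \<Rightarrow> 'a list" +
  fixes T :: "'a set \<Rightarrow> 'a set"
  assumes simplicial: "simplicial_map G T" and bijective: "bij_betw T G G"
begin

abbreviation U :: "('a set \<Rightarrow> real) \<Rightarrow> ('a set \<Rightarrow> real)" where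
  "U \<equiv> koopman G ord T"

section \<open>The vertex map of an automorphism\<close>

lemma T_simplex: "x \<in> G \<Longrightarrow> T x \<in> G"
  and T_mono: "x \<in> G \<Longrightarrow> y \<in> G \<Longrightarrow> x \<subseteq> y \<Longrightarrow> T x \<subseteq> T y"
  using simplicial by (simp_all add: simplicial_map_def)

lemma T_vertex:
  assumes "v \<in> \<Union>G"
  shows "{v} \<in> G" "T {v} = {vertex_map T v}"
proof -
  show v: "{v} \<in> G" using assms face_closed by blast
  then have "sdim (T {v}) = 0"
    using simplicial by (auto simp: simplicial_map_def sdim_def)
  \<comment> \<open>Dimension 0 alone would not exclude the empty set, because of truncated
    subtraction; \<open>T {v}\<close> is non-empty as a simplex.\<close>
  then have "card (T {v}) = 1" using card_simplex[OF T_simplex[OF v]] by simp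
  then obtain u where "T {v} = {u}" by (rule card_1_singletonE)
  then show "T {v} = {vertex_map T v}" by (simp add: vertex_map_def)
qed

lemma inj_vertex_map: "inj_on (vertex_map T) (\<Union>G)"
proof (rule inj_onI)
  fix v w assume "v \<in> \<Union>G" "w \<in> \<Union>G" "vertex_map T v = vertex_map T w"
  then have "{v} \<in> G" "{w} \<in> G" "T {v} = T {w}" using T_vertex by simp_all
  then show "v = w" using bijective by (metis bij_betw_def inj_onD singleton_inject)
qed

text \<open>Monotonicity on the singletons of \<open>x\<close> gives this inclusion; equality
  follows later by counting.\<close>

lemma vertex_map_subset:
  assumes "x \<in> G"
  shows "vertex_map T ` x \<subseteq> T x"
proof
  fix u assume "u \<in> vertex_map T ` x"
  then obtain v where v: "v \<in> x" "u = vertex_map T v" by blast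
  then have "v \<in> \<Union>G" using assms by blast
  then have "{v} \<in> G" "T {v} = {u}" using T_vertex v by simp_all
  then show "u \<in> T x" using T_mono[of "{v}" x] assms v by simp
qed

text \<open>
  The vertex map is injective, so \<open>T\<close> does not decrease cardinalities; as \<open>T\<close> is a bijection of a
  finite complex, it preserves the sum of all cardinalities and hence each one of them.
\<close>
lemma card_T:
  assumes "x \<in> G"
  shows "card (T x) = card x"
proof -
  have le: "card y \<le> card (T y)" if y: "y \<in> G" for y
  proof -
    have "inj_on (vertex_map T) y" using inj_vertex_map y by (meson Union_upper inj_on_subset)
    then have "card y = card (vertex_map T ` y)" by (simp add: card_image)
    also have "\<dots> \<le> card (T y)"
      by (rule card_mono[OF simplex_finite[OF T_simplex[OF y]] vertex_map_subset[OF y]])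
    finally show ?thesis .
  qed
  have "(\<Sum>y\<in>G. card y) = (\<Sum>y\<in>G. card (T y))"
    using sum.reindex_bij_betw[OF bijective, of card] by simp
  then show ?thesis
    using sum_mono_inv[of card G "\<lambda>y. card (T y)" x] le assms finite_complex by simp
qed

lemma T_eq_image:
  assumes "x \<in> G"
  shows "T x = vertex_map T ` x"
proof -
  have "inj_on (vertex_map T) x" using inj_vertex_map assms by (meson Union_upper inj_on_subset)
  then have "card (vertex_map T ` x) = card (T x)" by (simp add: card_image card_T assms)
  then show ?thesis
    using card_subset_eq[OF simplex_finite[OF T_simplex[OF assms]] vertex_map_subset[OF assms]]
    by simp
qed

lemma sdim_T: "x \<in> G \<Longrightarrow> sdim (T x) = sdim x"
  by (simp add: sdim_def card_T)

text \<open>Only \<open>T\<close> is assumed monotone; that it also reflects inclusions comes from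
  the injectivity of its vertex map.\<close>

lemma T_subset_iff:
  assumes "x \<in> G" "y \<in> G"
  shows "T y \<subseteq> T x \<longleftrightarrow> y \<subseteq> x"
proof
  assume sub: "T y \<subseteq> T x"
  show "y \<subseteq> x"
  proof
    fix v assume v: "v \<in> y"
    then have "vertex_map T v \<in> vertex_map T ` x"
      using sub T_eq_image assms by blast
    then show "v \<in> x"
      using inj_on_image_mem_iff[OF inj_vertex_map] v assms by blast
  qed
qed (rule T_mono[OF assms(2,1)])

lemma T_psubset_iff: "x \<in> G \<Longrightarrow> y \<in> G \<Longrightarrow> T y \<subset> T x \<longleftrightarrow> y \<subset> x"
  by (simp add: less_le_not_le T_subset_iff)

section \<open>Signs under \<open>T\<close> and commutation with \<open>d\<close> and its
  adjoint\<close>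

lemma bij_betw_facets: "x \<in> G \<Longrightarrow> bij_betw T (facets x) (facets (T x))"
  unfolding facets_def by (rule bij_betw_Collect[OF bijective]) (simp add: T_psubset_iff sdim_T)

lemma bij_betw_cofacets: "x \<in> G \<Longrightarrow> bij_betw T (cofacets x) (cofacets (T x))"
  unfolding cofacets_def by (rule bij_betw_Collect[OF bijective]) (simp add: T_psubset_iff sdim_T)

lemma map_ord:
  assumes "x \<in> G"
  shows "distinct (map (vertex_map T) (ord x))" "set (map (vertex_map T) (ord x)) = T x"
proof -
  have "inj_on (vertex_map T) x" using inj_vertex_map assms by (meson Union_upper inj_on_subset)
  then show "distinct (map (vertex_map T) (ord x))" "set (map (vertex_map T) (ord x)) = T x"
    by (simp_all add: distinct_map ord_distinct ord_set T_eq_image assms)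
qed

lemma map_sign_square:
  assumes "x \<in> G"
  shows "map_sign ord T x * map_sign ord T x = 1"
  unfolding map_sign_def
  using assms by (intro tuple_sign_square) (simp_all only: map_ord ord_distinct ord_set T_simplex)

text \<open>Both sides are the sign relating the \<open>T\<close>-image of \<open>(v, y)\<close> to the chosen order of \<open>T x\<close>.\<close>
lemma face_sign_map_sign:
  assumes x: "x \<in> G" and y: "y \<in> facets x"
  shows "face_sign ord x y * map_sign ord T x = map_sign ord T y * face_sign ord (T x) (T y)"
proof -
  obtain v where v: "v \<notin> y" "x = insert v y" "y \<in> G" by (rule facetE[OF x y])
  let ?t = "vertex_map T"
  have inj: "inj_on ?t x" using inj_vertex_map x by (meson Union_upper inj_on_subset)
  have Tx: "T x = insert (?t v) (T y)" using v x by (simp add: T_eq_image)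
  have tv: "?t v \<notin> T y" using inj v by (simp add: T_eq_image)
  note s = map_ord[OF x] map_ord[OF v(3)] ord_distinct[OF x] ord_set[OF x]
    ord_distinct[OF v(3)] ord_set[OF v(3)] ord_distinct[OF T_simplex[OF x]] ord_set[OF T_simplex[OF x]]
    ord_distinct[OF T_simplex[OF v(3)]] ord_set[OF T_simplex[OF v(3)]]
  have "face_sign ord x y = tuple_sign (v # ord y) (ord x)"
    unfolding v(2) by (rule face_sign_insert[OF v(1)])
  also have "\<dots> = tuple_sign (map ?t (v # ord y)) (map ?t (ord x))"
    using s v inj by (intro tuple_sign_map[symmetric]) auto
  finally have "face_sign ord x y * map_sign ord T x =
      tuple_sign (map ?t (v # ord y)) (map ?t (ord x)) * tuple_sign (map ?t (ord x)) (ord (T x))"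
    by (simp add: map_sign_def)
  also have "\<dots> = tuple_sign (?t v # map ?t (ord y)) (ord (T x))"
    using s tv Tx by (subst tuple_sign_trans) auto
  \<comment> \<open>The intermediate tuple \<open>?t v # ord (T y)\<close> separates the sign of
    \<open>T\<close> on \<open>y\<close> from the incidence sign of the image face.\<close>
  also have "\<dots> = tuple_sign (?t v # map ?t (ord y)) (?t v # ord (T y)) *
      tuple_sign (?t v # ord (T y)) (ord (T x))"
    using s tv Tx by (subst tuple_sign_trans) auto
  also have "tuple_sign (?t v # map ?t (ord y)) (?t v # ord (T y)) = map_sign ord T y"
    unfolding map_sign_def using s tv by (intro tuple_sign_Cons) auto
  also have "tuple_sign (?t v # ord (T y)) (ord (T x)) = face_sign ord (T x) (T y)"
    unfolding Tx by (rule face_sign_insert[OF tv, symmetric])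
  finally show ?thesis .
qed

text \<open>Since map signs square to 1, they can be moved across the identity. The first form
  serves \<open>d\<close>, the second \<open>coderiv\<close>.\<close>

lemma face_sign_T:
  assumes x: "x \<in> G" and y: "y \<in> facets x"
  shows "map_sign ord T x * face_sign ord (T x) (T y) = face_sign ord x y * map_sign ord T y"
    and "map_sign ord T y * face_sign ord (T x) (T y) = face_sign ord x y * map_sign ord T x"
proof -
  have yG: "y \<in> G" using y by (simp add: facets_def)
  note e = face_sign_map_sign[OF x y]
  show "map_sign ord T y * face_sign ord (T x) (T y) = face_sign ord x y * map_sign ord T x"
    using e by simp
  have "map_sign ord T x * face_sign ord (T x) (T y) =
      map_sign ord T x * (map_sign ord T y * map_sign ord T y) * face_sign ord (T x) (T y)"
    by (simp add: map_sign_square[OF yG])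
  also have "\<dots> = map_sign ord T x * map_sign ord T y * (face_sign ord x y * map_sign ord T x)"
    by (simp add: e mult.assoc)
  also have "\<dots> = (map_sign ord T x * map_sign ord T x) * (face_sign ord x y * map_sign ord T y)"
    by (simp only: mult_ac)
  finally show "map_sign ord T x * face_sign ord (T x) (T y) = face_sign ord x y * map_sign ord T y"
    by (simp add: map_sign_square[OF x])
qed

text \<open>\<open>T\<close> carries the facets of \<open>x\<close> onto those of
  \<open>T x\<close>; after this reindexing the summands agree by the sign rule.\<close>

lemma koopman_ext_deriv: "U (d f) = d (U f)"
proof
  fix x
  show "U (d f) x = d (U f) x"
  proof (cases "x \<in> G")
    case x: True
    have "U (d f) x = (\<Sum>y\<in>facets (T x). map_sign ord T x * face_sign ord (T x) y * f y)"
      using x by (simp add: koopman_def ext_deriv_eq T_simplex sum_distrib_left mult.assoc)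
    also have "\<dots> = (\<Sum>y\<in>facets x. map_sign ord T x * face_sign ord (T x) (T y) * f (T y))"
      by (rule sum.reindex_bij_betw[OF bij_betw_facets[OF x], symmetric])
    also have "\<dots> = (\<Sum>y\<in>facets x. face_sign ord x y * U f y)"
      by (intro sum.cong refl) (simp add: face_sign_T[OF x] koopman_def, simp add: facets_def)
    finally show ?thesis using x by (simp add: ext_deriv_eq)
  qed (simp add: koopman_def ext_deriv_eq)
qed

lemma koopman_coderiv: "U (coderiv f) = coderiv (U f)"
proof
  fix y
  show "U (coderiv f) y = coderiv (U f) y"
  proof (cases "y \<in> G")
    case y: True
    have "U (coderiv f) y = (\<Sum>x\<in>cofacets (T y). map_sign ord T y * face_sign ord x (T y) * f x)"
      using y by (simp add: koopman_def coderiv_def T_simplex sum_distrib_left mult.assoc)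
    also have "\<dots> = (\<Sum>x\<in>cofacets y. map_sign ord T y * face_sign ord (T x) (T y) * f (T x))"
      by (rule sum.reindex_bij_betw[OF bij_betw_cofacets[OF y], symmetric])
    also have "\<dots> = (\<Sum>x\<in>cofacets y. face_sign ord x y * U f x)"
    proof (intro sum.cong refl)
      fix x assume "x \<in> cofacets y"
      then have "x \<in> G" "y \<in> facets x" using y by (auto simp: facets_def cofacets_def)
      then show "map_sign ord T y * face_sign ord (T x) (T y) * f (T x) = face_sign ord x y * U f x"
        by (simp add: face_sign_T koopman_def)
    qed
    finally show ?thesis using y by (simp add: coderiv_def)
  qed (simp add: koopman_def coderiv_def)
qed

section \<open>Traces of the Koopman operator\<close>

lemma linear_koopman: "fun_linear U"
  by (rule fun_linearI) (auto simp: fun_eq_iff koopman_def fscale_def algebra_simps)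

lemma koopman_k_forms: "f \<in> k_forms G k \<Longrightarrow> U f \<in> k_forms G k"
  by (auto simp: k_forms_def forms_def koopman_def sdim_T)

lemma koopman_closed_forms: "f \<in> closed_forms k \<Longrightarrow> U f \<in> closed_forms k"
  using koopman_k_forms fun_pair.linear_0[OF linear_koopman]
  by (auto simp: closed_forms_def simp flip: koopman_ext_deriv)

text \<open>The diagonal entry at \<open>x\<close> is
  \<open>map_sign ord T x * delta x (T x)\<close>, which vanishes unless
  \<open>T x = x\<close>.\<close>

lemma trace_k_forms:
  "trace_on (k_forms G k) U = (\<Sum>x | x \<in> fixed_simplices G T \<and> sdim x = k. map_sign ord T x)"
proof -
  let ?S = "{x \<in> G. sdim x = k}"
  have "trace_on (k_forms G k) U = (\<Sum>x\<in>?S. U (delta x) x)"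
    unfolding k_forms_def using finite_complex linear_koopman koopman_k_forms[unfolded k_forms_def]
    by (intro trace_on_forms) auto
  also have "\<dots> = (\<Sum>x\<in>{x \<in> ?S. T x = x}. map_sign ord T x)"
    using finite_complex by (intro sum.mono_neutral_cong_right) (auto simp: koopman_def delta_def)
  also have "{x \<in> ?S. T x = x} = {x. x \<in> fixed_simplices G T \<and> sdim x = k}"
    by (auto simp: fixed_simplices_def)
  finally show ?thesis .
qed

lemma trace_k_forms_split:
  "trace_on (k_forms G k) U = trace_on (closed_forms k) U + trace_on (exact_forms (Suc k)) U"
  unfolding closed_forms_def exact_forms_def pred_forms_Suc
proof (rule trace_on_kernel_image[OF linear_koopman linear_ext_deriv _ _ k_forms_subset_span])
  show "fun_space.subspace (k_forms G k)" unfolding k_forms_def by (rule subspace_forms)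
qed (use finite_complex koopman_k_forms koopman_ext_deriv in auto)

text \<open>\<open>U\<close> commutes with both factors of the operator taking \<open>f\<close> to
  \<open>d (coderiv f)\<close>, whose kernel and image on the closed forms are the harmonic and the
  exact forms.\<close>

lemma trace_closed_forms:
  "trace_on (closed_forms k) U = trace_on (harmonic_forms G ord k) U + trace_on (exact_forms k) U"
  unfolding harmonic_forms_eq d_coderiv_closed_forms[symmetric]
proof (rule trace_on_kernel_image[OF linear_koopman linear_d_coderiv subspace_closed_forms])
  show "finite (delta ` {x \<in> G. sdim x = k})" using finite_complex by simp
  show "closed_forms k \<subseteq> fun_space.span (delta ` {x \<in> G. sdim x = k})"
    using k_forms_subset_span by (force simp: closed_forms_def)
qed (simp_all add: koopman_closed_forms koopman_ext_deriv koopman_coderiv)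

lemma sdim_le_max_dim: "x \<in> G \<Longrightarrow> sdim x \<le> max_dim G"
  using finite_complex by (simp add: max_dim_def)

lemma lefschetz_fixed_point:
  "lefschetz_number G ord T = (\<Sum>x\<in>fixed_simplices G T. fixed_index ord T x)"
proof -
  let ?q = "max_dim G" and ?e = "\<lambda>k. trace_on (exact_forms k) U"
  have harmonic: "trace_on (harmonic_forms G ord k) U = trace_on (k_forms G k) U - ?e k - ?e (Suc k)" for k
    by (simp add: trace_k_forms_split trace_closed_forms)
  \<comment> \<open>There are no non-zero forms of degree -1, so the lower boundary term
    vanishes.\<close>
  have e0: "?e 0 = 0"
    by (simp add: exact_forms_def pred_forms_0 fun_pair.linear_0[OF linear_ext_deriv] trace_on_zero)
  \<comment> \<open>No simplex exceeds the maximal dimension, so the upper boundary term vanishes;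
    for empty \<open>G\<close> this holds whatever value \<open>?q\<close> has.\<close>
  have "k_forms G (Suc ?q) = {0}"
    using sdim_le_max_dim by (fastforce simp: k_forms_def forms_def)
  then have "exact_forms (Suc ?q) = {0}"
    using exact_subset_closed[of "Suc ?q"] fun_space.subspace_0[OF subspace_exact_forms, of "Suc ?q"]
    by (auto simp: closed_forms_def)
  then have eq: "?e (Suc ?q) = 0" by (simp add: trace_on_zero)
  \<comment> \<open>Each intermediate trace occurs twice with opposite signs; only the two boundary
    terms remain.\<close>
  have tel: "(\<Sum>k=0..n. (-1) ^ k * (?e k + ?e (Suc k))) = ?e 0 + (-1) ^ n * ?e (Suc n)" for n
    by (induction n) (simp_all add: algebra_simps)
  have "lefschetz_number G ord T = (\<Sum>k=0..?q. (-1) ^ k * trace_on (k_forms G k) U)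
      - (\<Sum>k=0..?q. (-1) ^ k * (?e k + ?e (Suc k)))"
    by (simp add: lefschetz_number_def harmonic flip: sum_subtractf) (simp add: algebra_simps)
  also have "\<dots> = (\<Sum>k=0..?q. (-1) ^ k * trace_on (k_forms G k) U)"
    by (simp add: tel e0 eq)
  also have "\<dots> = (\<Sum>k=0..?q. \<Sum>x | x \<in> fixed_simplices G T \<and> sdim x = k. fixed_index ord T x)"
    by (simp add: trace_k_forms sum_distrib_left fixed_index_def omega_def)
  \<comment> \<open>Every fixed simplex is counted exactly once, in the summand of its
    dimension.\<close>
  also have "\<dots> = (\<Sum>x\<in>fixed_simplices G T. fixed_index ord T x)"
    using finite_complex sdim_le_max_dim by (intro sum.group) (auto simp: fixed_simplices_def)
  finally show ?thesis .
qed

end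

theorem mainTheorem9:
  fixes G :: "'a set set"
    and ord :: "'a set \<Rightarrow> 'a list"
    and T :: "'a set \<Rightarrow> 'a set"
  assumes "simplicial_complex G"
    and "vertex_ordering G ord"
    and "simplicial_map G T"
    and "bij_betw T G G"
  shows "lefschetz_number G ord T = (\<Sum>x\<in>fixed_simplices G T. fixed_index ord T x)"
proof -
  interpret complex_automorphism G ord T
    using assms by unfold_locales
  show ?thesis by (rule lefschetz_fixed_point)
qed

end
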